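(* Let $K_1,K_2$ be positive integers, $0<\gamma<1$ and $c=\sqrt{\frac{K_1}{C_0K_2}}$. Let $R,T>0$, and let $\mathbf{u}$ be a weak solution to the 3D Euler equations on $B(\mathbf{0},2R)\times(0,2T)$ satisfying the local energy inequality and smooth on $\bigl(B(\mathbf{0},2R)\setminus\{\mathbf{0}\}\bigr)\times(0,2T)$. Assume that the strict energy inequality holds on $B(\mathbf{0},2R^* )\times(0,2T)$ for some $R^*$ with $0<R^*\le R$, i.e., $\varepsilon_{\mathbf{0},R^*}>0$. Then there exists $R_0^*$ with $0<R_0^*\le R$ such that the cascade condition $$\tau_0<\gamma\,c\,R_0$$ holds for any $R_0$ with $0<R_0\le R_0^*$ (where $\tau_0=\tau_0(R_0)$ is the anomalous Taylor length scale associated with $B(\mathbf{0},R_0)$).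
   Context: Notation: $B(\mathbf{x},r)$ is the ball in $\mathbb{R}^3$ with center $\mathbf{x}$ and radius $r$; $\mathcal{D}(U)$ denotes smooth functions with compact support in $U$. Euler equations: $\mathbf{u}_t+(\mathbf{u}\cdot\nabla)\mathbf{u}=-\nabla p$, $\operatorname{div}\mathbf{u}=0$, understood in the sense of distributions, with $\mathbf{u}\in L^3_{loc}$ in space-time (the relation $-\Delta p=\partial_i\partial_j(u^iu^j)$ and local elliptic theory then make all integrals below well defined). The local energy inequality means $$\frac12\iint|\mathbf{u}|^2\partial_t\phi\,d\mathbf{x}\,dt+\iint\Bigl(\frac12|\mathbf{u}|^2+p\Bigr)\mathbf{u}\cdot\nabla\phi\,d\mathbf{x}\,dt\ge0$$ for all nonnegative test functions $\phi$ on $B(\mathbf{0},2R)\times(0,2T)$. Cut-offs: fix $0<\delta\le1$, a constant $C_0>0$ and $\eta\in\mathcal{D}(0,2T)$ with $0\le\eta\le1$, $\eta=1$ on $(T/4,5T/4)$, and $|\eta'|/\eta^\delta\le C_0/T$. For each $\rho$ with $0<\rho\le R$ choose $\psi_{\mathbf{0},\rho}\in\mathcal{D}(B(\mathbf{0},2\rho))$ with $0\le\psi_{\mathbf{0},\rho}\le1$ and $\psi_{\mathbf{0},\rho}=1$ on $B(\mathbf{0},\rho)$, and set $\phi_{\mathbf{0},\rho}(t,\mathbf{x})=\eta(t)\psi_{\mathbf{0},\rho}(\mathbf{x})$. Anomalous dissipation: $$\varepsilon_{\mathbf{0},\rho}=\iint\frac12|\mathbf{u}|^2\partial_t\phi_{\mathbf{0},\rho}\,d\mathbf{x}\,dt+\iint\Bigl(\frac12|\mathbf{u}|^2+p\Bigr)\mathbf{u}\cdot\nabla\phi_{\mathbf{0},\rho}\,d\mathbf{x}\,dt\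 (\ge0).$$ For $0<R_0\le R$, put $$\mathsf{e}_0=\frac1T\frac1{R_0^3}\iint\frac12|\mathbf{u}|^2\phi_{\mathbf{0},R_0}^{\delta}\,d\mathbf{x}\,dt,\qquad \varepsilon_0=\frac1T\frac1{R_0^3}\varepsilon_{\mathbf{0},R_0},\qquad \tau_0=\Bigl(\frac{R_0^2}{T}\frac{\mathsf{e}_0}{\varepsilon_0}\Bigr)^{1/2}$$ (with $\tau_0$ defined when $\varepsilon_0>0$). The integers $K_1,K_2$ enter only through $c$; they are the multiplicities of the $(K_1,K_2)$-covers used for ensemble averaging: a cover $\{B(\mathbf{x}_i,\rho)\}_{i=1}^n$ of $B(\mathbf{0},R_0)$ is a $(K_1,K_2)$-cover at scale $\rho$, $0<\rho\le R_0$, if $(R_0/\rho)^3\le n\le K_1(R_0/\rho)^3$ and any point of $B(\mathbf{0},R_0)$ is covered by at most $K_2$ of the balls $B(\mathbf{x}_i,2\rho)$. *)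

theory Defs
  imports "HOL-Analysis.Analysis"
begin

text \<open>
  \<open>Ck_on k S f\<close> is meant for open \<open>S\<close> only: all iterated directional derivatives of \<open>f\<close> of order
  at most \<open>k\<close> exist and are continuous on \<open>S\<close>.
\<close>

primrec Ck_on :: "nat \<Rightarrow> 'a::euclidean_space set \<Rightarrow> ('a \<Rightarrow> 'b::real_normed_vector) \<Rightarrow> bool" where
  "Ck_on 0 S f \<longleftrightarrow> continuous_on S f"
| "Ck_on (Suc k) S f \<longleftrightarrow>
     (\<forall>x\<in>S. f differentiable (at x)) \<and> (\<forall>v. Ck_on k S (\<lambda>x. frechet_derivative f (at x) v))"

definition smooth_on :: "'a::euclidean_space set \<Rightarrow> ('a \<Rightarrow> 'b::real_normed_vector) \<Rightarrow> bool" where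
  "smooth_on S f \<longleftrightarrow> (\<forall>k. Ck_on k S f)"

text \<open>Elements of \<open>\<D>(U)\<close> are represented by their extension by zero to the whole space.\<close>

definition test_function :: "'a::euclidean_space set \<Rightarrow> ('a \<Rightarrow> real) \<Rightarrow> bool" where
  "test_function U f \<longleftrightarrow>
     smooth_on UNIV f \<and> compact (closure {x. f x \<noteq> 0}) \<and> closure {x. f x \<noteq> 0} \<subseteq> U"

definition locally_Lp :: "real \<Rightarrow> 'a::euclidean_space set \<Rightarrow> ('a \<Rightarrow> 'b::euclidean_space) \<Rightarrow> bool" where
  "locally_Lp q U f \<longleftrightarrow>
     f \<in> borel_measurable (lebesgue_on U) \<and>
     (\<forall>K. compact K \<and> K \<subseteq> U \<longrightarrow> integrable (lebesgue_on K) (\<lambda>z. norm (f z) powr q))"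

text \<open>A space-time point is a pair \<open>(x, t)\<close>.\<close>

type_synonym spacetime = "(real^3) \<times> real"

definition cylinder :: "real \<Rightarrow> real \<Rightarrow> spacetime set" where
  "cylinder R T = ball 0 (2 * R) \<times> {0<..<2 * T}"

definition time_deriv :: "(spacetime \<Rightarrow> real) \<Rightarrow> spacetime \<Rightarrow> real" where
  "time_deriv f z = frechet_derivative f (at z) (0, 1)"

definition space_grad :: "(spacetime \<Rightarrow> real) \<Rightarrow> spacetime \<Rightarrow> real^3" where
  "space_grad f z = (\<chi> i. frechet_derivative f (at z) (axis i 1, 0))"

text \<open>
  The nonlinear term is read in divergence form, \<open>((u \<bullet> \<nabla>) u)\<^sub>i = \<Sum>\<^sub>j \<partial>\<^sub>j (u\<^sub>i u\<^sub>j)\<close> for divergence-free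
  \<open>u\<close>, and all derivatives are moved to the test function.  The pressure is determined only up to
  a function of time.  For \<open>u\<close> in \<open>L\<^sup>3\<close> locally, the usual choice of \<open>p\<close> lies in \<open>L\<^bsup>3/2\<^esup>\<close> locally;
  only the consequence that \<open>p\<close> and \<open>p u\<close> are locally integrable is required, which is exactly
  what makes the integrals involving \<open>p\<close> well defined.
\<close>

definition euler_weak_solution ::
    "spacetime set \<Rightarrow> (spacetime \<Rightarrow> real^3) \<Rightarrow> (spacetime \<Rightarrow> real) \<Rightarrow> bool" where
  "euler_weak_solution U u p \<longleftrightarrow>
     locally_Lp 3 U u \<and> locally_Lp 1 U p \<and> locally_Lp 1 U (\<lambda>z. p z *\<^sub>R u z) \<and>
     (\<forall>\<phi>. test_function U \<phi> \<longrightarrow>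
        (\<forall>i. (LINT z:U|lebesgue.
               u z $ i * time_deriv \<phi> z + u z $ i * (u z \<bullet> space_grad \<phi> z)
               + p z * space_grad \<phi> z $ i) = 0) \<and>
        (LINT z:U|lebesgue. u z \<bullet> space_grad \<phi> z) = 0)"

definition local_energy ::
    "spacetime set \<Rightarrow> (spacetime \<Rightarrow> real^3) \<Rightarrow> (spacetime \<Rightarrow> real) \<Rightarrow> (spacetime \<Rightarrow> real) \<Rightarrow> real" where
  "local_energy U u p \<phi> =
     (LINT z:U|lebesgue. 1/2 * (norm (u z))\<^sup>2 * time_deriv \<phi> z) +
     (LINT z:U|lebesgue. (1/2 * (norm (u z))\<^sup>2 + p z) * (u z \<bullet> space_grad \<phi> z))"

definition local_energy_inequality ::
    "spacetime set \<Rightarrow> (spacetime \<Rightarrow> real^3) \<Rightarrow> (spacetime \<Rightarrow> real) \<Rightarrow> bool" where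
  "local_energy_inequality U u p \<longleftrightarrow>
     (\<forall>\<phi>. test_function U \<phi> \<and> (\<forall>z. 0 \<le> \<phi> z) \<longrightarrow> 0 \<le> local_energy U u p \<phi>)"

text \<open>
  At a zero of \<open>\<eta>\<close>, which is a minimum, \<open>\<eta>'\<close> vanishes as well; the quotient \<open>0/0\<close> is \<open>0\<close> there, so the
  last conjunct says \<open>\<bar>\<eta>'\<bar> \<le> (C0 / T) \<eta>\<^sup>\<delta>\<close> everywhere.
\<close>

definition time_cutoff :: "real \<Rightarrow> real \<Rightarrow> real \<Rightarrow> (real \<Rightarrow> real) \<Rightarrow> bool" where
  "time_cutoff T \<delta> C0 \<eta> \<longleftrightarrow>
     test_function {0<..<2 * T} \<eta> \<and> (\<forall>t. 0 \<le> \<eta> t \<and> \<eta> t \<le> 1) \<and>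
     (\<forall>t\<in>{T/4<..<5*T/4}. \<eta> t = 1) \<and>
     (\<forall>t. \<bar>deriv \<eta> t\<bar> / (\<eta> t powr \<delta>) \<le> C0 / T)"

definition space_cutoff :: "real \<Rightarrow> (real^3 \<Rightarrow> real) \<Rightarrow> bool" where
  "space_cutoff \<rho> \<psi> \<longleftrightarrow>
     test_function (ball 0 (2 * \<rho>)) \<psi> \<and> (\<forall>x. 0 \<le> \<psi> x \<and> \<psi> x \<le> 1) \<and> (\<forall>x\<in>ball 0 \<rho>. \<psi> x = 1)"

definition cutoff :: "(real \<Rightarrow> real) \<Rightarrow> (real \<Rightarrow> real^3 \<Rightarrow> real) \<Rightarrow> real \<Rightarrow> spacetime \<Rightarrow> real" where
  "cutoff \<eta> \<psi> \<rho> = (\<lambda>(x, t). \<eta> t * \<psi> \<rho> x)"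

definition anomalous_dissipation ::
    "real \<Rightarrow> real \<Rightarrow> (spacetime \<Rightarrow> real^3) \<Rightarrow> (spacetime \<Rightarrow> real) \<Rightarrow>
     (real \<Rightarrow> real) \<Rightarrow> (real \<Rightarrow> real^3 \<Rightarrow> real) \<Rightarrow> real \<Rightarrow> real" where
  "anomalous_dissipation R T u p \<eta> \<psi> \<rho> = local_energy (cylinder R T) u p (cutoff \<eta> \<psi> \<rho>)"

definition mean_energy ::
    "real \<Rightarrow> real \<Rightarrow> real \<Rightarrow> (spacetime \<Rightarrow> real^3) \<Rightarrow>
     (real \<Rightarrow> real) \<Rightarrow> (real \<Rightarrow> real^3 \<Rightarrow> real) \<Rightarrow> real \<Rightarrow> real" where
  "mean_energy R T \<delta> u \<eta> \<psi> R0 =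
     1 / T * (1 / R0 ^ 3) *
       (LINT z:cylinder R T|lebesgue. 1/2 * (norm (u z))\<^sup>2 * (cutoff \<eta> \<psi> R0 z powr \<delta>))"

definition mean_dissipation ::
    "real \<Rightarrow> real \<Rightarrow> (spacetime \<Rightarrow> real^3) \<Rightarrow> (spacetime \<Rightarrow> real) \<Rightarrow>
     (real \<Rightarrow> real) \<Rightarrow> (real \<Rightarrow> real^3 \<Rightarrow> real) \<Rightarrow> real \<Rightarrow> real" where
  "mean_dissipation R T u p \<eta> \<psi> R0 =
     1 / T * (1 / R0 ^ 3) * anomalous_dissipation R T u p \<eta> \<psi> R0"

text \<open>Meaningful only if \<open>mean_dissipation R T u p \<eta> \<psi> R0 > 0\<close>.\<close>

definition taylor_scale ::
    "real \<Rightarrow> real \<Rightarrow> real \<Rightarrow> (spacetime \<Rightarrow> real^3) \<Rightarrow> (spacetime \<Rightarrow> real) \<Rightarrow>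
     (real \<Rightarrow> real) \<Rightarrow> (real \<Rightarrow> real^3 \<Rightarrow> real) \<Rightarrow> real \<Rightarrow> real" where
  "taylor_scale R T \<delta> u p \<eta> \<psi> R0 =
     sqrt (R0\<^sup>2 / T * (mean_energy R T \<delta> u \<eta> \<psi> R0 / mean_dissipation R T u p \<eta> \<psi> R0))"

end

theory Submission
  imports Defs
begin

text \<open>
  The local energy balance is an equality wherever the solution is smooth: there one may multiply the
  momentum equation by \<open>u \<phi>\<close> and integrate by parts, so the dissipation of a test function whose
  support avoids the space origin is \<open>0\<close>.  Two cut-offs with the same time profile \<open>\<eta>\<close> but
  different radii agree near \<open>x = 0\<close>, hence their difference is such a test function, and the
  anomalous dissipation is the same number \<open>E > 0\<close> at every radius: all of it sits at the
  singularity.  The energy in the ball of radius \<open>2 R0\<close>, on the other hand, tends to \<open>0\<close> with \<open>R0\<close>,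
  because \<open>|u|\<^sup>2\<close> is locally integrable and the segment \<open>{0} \<times> (0, 2T)\<close> is a null set.  If \<open>G\<close> is
  the weighted energy at radius \<open>R0\<close>, the factors \<open>1 / (T R0\<^sup>3)\<close> cancel and
  \<open>\<tau>\<^sub>0\<^sup>2 = (R0\<^sup>2 / T) (G / E)\<close>, so that \<open>\<tau>\<^sub>0 < \<gamma> c R0\<close> just means \<open>G < (\<gamma> c)\<^sup>2 T E\<close>, which holds for
  all small \<open>R0\<close>.
  
  In the energy equality (\<open>local_energy_eq_0_of_smooth\<close>) no derivative falls on the pressure: the weak
  momentum equation is tested directly with \<open>u\<^sub>i \<phi>\<close>, a legitimate test function since \<open>u\<close> is smooth on
  the support of \<open>\<phi>\<close>; after summation over \<open>i\<close> the pressure is multiplied by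
  \<open>(div u) \<phi> + u \<bullet> \<nabla>\<phi>\<close>, and \<open>(div u) \<phi>\<close> vanishes almost everywhere
  (\<open>AE_divergence_mult_test_function_eq_0\<close>).  What remains is the energy density of \<open>\<phi>\<close> plus
  derivatives of test functions, whose integrals vanish (\<open>integral_dir_deriv_test_function\<close>).
\<close>

section \<open>Calculus of smooth functions\<close>

definition dir_deriv :: "'a::euclidean_space \<Rightarrow> ('a \<Rightarrow> 'b::real_normed_vector) \<Rightarrow> 'a \<Rightarrow> 'b" where
  "dir_deriv v f z = frechet_derivative f (at z) v"

lemma dir_deriv_eq: "(f has_derivative f') (at z) \<Longrightarrow> dir_deriv v f z = f' v"
  by (drule frechet_derivative_at) (simp add: dir_deriv_def)

lemma has_derivative_dir_deriv:
  "f differentiable (at z) \<Longrightarrow> (f has_derivative (\<lambda>v. dir_deriv v f z)) (at z)"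
  by (simp add: dir_deriv_def frechet_derivative_works)

text \<open>
  A rule such as the product rule gives the derivative only at points of \<open>S\<close>, so the function
  \<open>\<lambda>x. frechet_derivative f (at x) v\<close> is known on \<open>S\<close> alone.  The congruence lets the closure
  properties below replace it by an explicit formula at the next order.
\<close>

lemma Ck_on_cong:
  assumes "Ck_on k S f" "open S" "\<And>x. x \<in> S \<Longrightarrow> f x = g x"
  shows "Ck_on k S g"
  using assms
proof (induction k arbitrary: f g)
  case 0
  then show ?case by (simp cong: continuous_on_cong)
next
  case (Suc k)
  have d: "(g has_derivative frechet_derivative f (at x)) (at x)" if "x \<in> S" for x
  proof (rule has_derivative_transform_within_open[OF _ \<open>open S\<close> that])
    show "(f has_derivative frechet_derivative f (at x)) (at x)"
      using Suc.prems(1) that by (simp add: frechet_derivative_works[symmetric])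
  qed (use Suc.prems in auto)
  have "Ck_on k S (\<lambda>x. frechet_derivative g (at x) v)" for v
  proof (rule Suc.IH)
    show "Ck_on k S (\<lambda>x. frechet_derivative f (at x) v)" using Suc.prems(1) by simp
    show "frechet_derivative f (at x) v = frechet_derivative g (at x) v" if "x \<in> S" for x
      using frechet_derivative_at[OF d[OF that]] by simp
  qed fact
  with d show ?case by (auto simp: differentiable_def)
qed

lemma Ck_on_SucI:
  assumes "open S" "\<And>x. x \<in> S \<Longrightarrow> (f has_derivative D x) (at x)" "\<And>v. Ck_on k S (\<lambda>x. D x v)"
  shows "Ck_on (Suc k) S f"
proof -
  have "Ck_on k S (\<lambda>x. frechet_derivative f (at x) v)" for v
    by (rule Ck_on_cong[OF assms(3)[of v] assms(1)]) (simp add: frechet_derivative_at[OF assms(2), symmetric])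
  then show ?thesis using assms by (auto simp: differentiable_def)
qed

lemma Ck_on_SucD:
  assumes "Ck_on (Suc k) S f"
  shows "x \<in> S \<Longrightarrow> (f has_derivative (\<lambda>v. dir_deriv v f x)) (at x)" "Ck_on k S (dir_deriv v f)"
proof -
  have "dir_deriv v f = (\<lambda>x. frechet_derivative f (at x) v)"
    by (auto simp: dir_deriv_def)
  then show "Ck_on k S (dir_deriv v f)" using assms by auto
qed (use assms in \<open>auto intro: has_derivative_dir_deriv\<close>)

lemma Ck_on_SucE: "Ck_on (Suc k) S f \<Longrightarrow> Ck_on k S f"
proof (induction k arbitrary: f)
  case 0
  then show ?case
    by (auto intro!: continuous_at_imp_continuous_on differentiable_imp_continuous_within)
next
  case (Suc k)
  have *: "\<forall>x\<in>S. f differentiable (at x)" "\<And>v. Ck_on (Suc k) S (\<lambda>x. frechet_derivative f (at x) v)"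
    using Suc.prems unfolding Ck_on.simps(2)[of "Suc k"] by blast+
  show ?case
    unfolding Ck_on.simps(2)[of k] using *(1) Suc.IH[OF *(2)] by blast
qed

lemma Ck_on_subset: "Ck_on k S f \<Longrightarrow> T \<subseteq> S \<Longrightarrow> Ck_on k T f"
  by (induction k arbitrary: f) (auto intro: continuous_on_subset)

lemma Ck_on_Un: "Ck_on k S f \<Longrightarrow> Ck_on k T f \<Longrightarrow> open S \<Longrightarrow> open T \<Longrightarrow> Ck_on k (S \<union> T) f"
  by (induction k arbitrary: f) (auto intro: continuous_on_open_Un)

lemma Ck_on_const: "Ck_on k S (\<lambda>x. c)"
  by (induction k arbitrary: c) simp_all

lemma Ck_on_add:
  assumes "Ck_on k S f" "Ck_on k S g" "open S"
  shows "Ck_on k S (\<lambda>x. f x + g x)"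
  using assms
proof (induction k arbitrary: f g)
  case (Suc k)
  note f = Ck_on_SucD[OF Suc.prems(1)] and g = Ck_on_SucD[OF Suc.prems(2)]
  show ?case
  proof (rule Ck_on_SucI[OF \<open>open S\<close>])
    show "((\<lambda>x. f x + g x) has_derivative (\<lambda>v. dir_deriv v f x + dir_deriv v g x)) (at x)"
      if "x \<in> S" for x
      by (rule has_derivative_add[OF f(1) g(1)]) (fact that)+
    show "Ck_on k S (\<lambda>x. dir_deriv v f x + dir_deriv v g x)" for v
      by (rule Suc.IH[OF f(2) g(2) \<open>open S\<close>])
  qed
qed (simp add: continuous_on_add)

lemma Ck_on_mult:
  fixes f g :: "'a::euclidean_space \<Rightarrow> real"
  assumes "Ck_on k S f" "Ck_on k S g" "open S"
  shows "Ck_on k S (\<lambda>x. f x * g x)"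
  using assms
proof (induction k arbitrary: f g)
  case (Suc k)
  note f = Ck_on_SucD[OF Suc.prems(1)] and g = Ck_on_SucD[OF Suc.prems(2)]
  show ?case
  proof (rule Ck_on_SucI[OF \<open>open S\<close>])
    show "((\<lambda>x. f x * g x) has_derivative (\<lambda>v. f x * dir_deriv v g x + dir_deriv v f x * g x)) (at x)"
      if "x \<in> S" for x
      by (rule has_derivative_mult[OF f(1) g(1)]) (fact that)+
    show "Ck_on k S (\<lambda>x. f x * dir_deriv v g x + dir_deriv v f x * g x)" for v
      by (rule Ck_on_add[OF Suc.IH[OF Ck_on_SucE[OF Suc.prems(1)] g(2) \<open>open S\<close>]
             Suc.IH[OF f(2) Ck_on_SucE[OF Suc.prems(2)] \<open>open S\<close>] \<open>open S\<close>])
  qed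
qed (simp add: continuous_on_mult)

lemma Ck_on_bounded_linear:
  assumes "Ck_on k S f" "open S" "bounded_linear h"
  shows "Ck_on k S (\<lambda>x. h (f x))"
  using assms
proof (induction k arbitrary: f)
  case (Suc k)
  note f = Ck_on_SucD[OF Suc.prems(1)]
  show ?case
  proof (rule Ck_on_SucI[OF \<open>open S\<close>])
    show "((\<lambda>x. h (f x)) has_derivative (\<lambda>v. h (dir_deriv v f x))) (at x)" if "x \<in> S" for x
      by (rule bounded_linear.has_derivative[OF \<open>bounded_linear h\<close> f(1)[OF that]])
    show "Ck_on k S (\<lambda>x. h (dir_deriv v f x))" for v
      by (rule Suc.IH[OF f(2) \<open>open S\<close> \<open>bounded_linear h\<close>])
  qed
qed (simp add: bounded_linear.continuous_on)

lemma Ck_on_compose_bounded_linear: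
  assumes "Ck_on k UNIV f" "bounded_linear h"
  shows "Ck_on k UNIV (\<lambda>x. f (h x))"
  using assms
proof (induction k arbitrary: f)
  case 0
  then show ?case by (auto intro: continuous_on_compose2[of UNIV f] linear_continuous_on)
next
  case (Suc k)
  show ?case
  proof (rule Ck_on_SucI[where D = "\<lambda>x v. dir_deriv (h v) f (h x)"])
    fix x
    show "((\<lambda>x. f (h x)) has_derivative (\<lambda>v. dir_deriv (h v) f (h x))) (at x)"
      by (rule has_derivative_compose[OF bounded_linear_imp_has_derivative[OF Suc.prems(2)]
              Ck_on_SucD(1)[OF Suc.prems(1)]]) simp
    show "Ck_on k UNIV (\<lambda>x. dir_deriv (h v) f (h x))" for v
      by (rule Suc.IH[OF Ck_on_SucD(2)[OF Suc.prems(1)] Suc.prems(2)])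
  qed simp
qed

lemma smooth_on_differentiable:
  "smooth_on S f \<Longrightarrow> z \<in> S \<Longrightarrow> f differentiable (at z)"
  unfolding smooth_on_def by (drule spec[of _ "Suc 0"]) simp

lemma smooth_on_imp_continuous_on: "smooth_on S f \<Longrightarrow> continuous_on S f"
  unfolding smooth_on_def by (drule spec[of _ 0]) simp

lemma smooth_on_dir_deriv: "smooth_on S f \<Longrightarrow> smooth_on S (dir_deriv v f)"
  unfolding smooth_on_def using Ck_on_SucD(2) by blast

lemma smooth_on_cong: "smooth_on S f \<Longrightarrow> open S \<Longrightarrow> (\<And>x. x \<in> S \<Longrightarrow> f x = g x) \<Longrightarrow> smooth_on S g"
  unfolding smooth_on_def using Ck_on_cong by blast

lemma smooth_on_subset: "smooth_on S f \<Longrightarrow> T \<subseteq> S \<Longrightarrow> smooth_on T f"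
  unfolding smooth_on_def using Ck_on_subset by blast

lemma smooth_on_Un: "smooth_on S f \<Longrightarrow> smooth_on T f \<Longrightarrow> open S \<Longrightarrow> open T \<Longrightarrow> smooth_on (S \<union> T) f"
  unfolding smooth_on_def using Ck_on_Un by blast

lemma smooth_on_const: "smooth_on S (\<lambda>x. c)"
  unfolding smooth_on_def by (simp add: Ck_on_const)

lemma smooth_on_add: "smooth_on S f \<Longrightarrow> smooth_on S g \<Longrightarrow> open S \<Longrightarrow> smooth_on S (\<lambda>x. f x + g x)"
  unfolding smooth_on_def using Ck_on_add by blast

lemma smooth_on_sum:
  "(\<And>i. i \<in> I \<Longrightarrow> smooth_on S (f i)) \<Longrightarrow> open S \<Longrightarrow> smooth_on S (\<lambda>x. \<Sum>i\<in>I. f i x)"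
  by (induction I rule: infinite_finite_induct) (auto intro: smooth_on_add smooth_on_const)

lemma smooth_on_mult:
  fixes f g :: "'a::euclidean_space \<Rightarrow> real"
  shows "smooth_on S f \<Longrightarrow> smooth_on S g \<Longrightarrow> open S \<Longrightarrow> smooth_on S (\<lambda>x. f x * g x)"
  unfolding smooth_on_def using Ck_on_mult by blast

lemma smooth_on_bounded_linear:
  "smooth_on S f \<Longrightarrow> open S \<Longrightarrow> bounded_linear h \<Longrightarrow> smooth_on S (\<lambda>x. h (f x))"
  unfolding smooth_on_def using Ck_on_bounded_linear by blast

lemma smooth_on_compose_bounded_linear:
  "smooth_on UNIV f \<Longrightarrow> bounded_linear h \<Longrightarrow> smooth_on UNIV (\<lambda>x. f (h x))"
  unfolding smooth_on_def using Ck_on_compose_bounded_linear by blast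

lemma dir_deriv_mult:
  fixes f g :: "'a::euclidean_space \<Rightarrow> real"
  assumes "f differentiable (at z)" "g differentiable (at z)"
  shows "dir_deriv v (\<lambda>z. f z * g z) z = f z * dir_deriv v g z + dir_deriv v f z * g z"
  by (rule dir_deriv_eq[OF has_derivative_mult]) (use assms in \<open>auto intro: has_derivative_dir_deriv\<close>)

lemma dir_deriv_diff:
  assumes "f differentiable (at z)" "g differentiable (at z)"
  shows "dir_deriv v (\<lambda>z. f z - g z) z = dir_deriv v f z - dir_deriv v g z"
  by (rule dir_deriv_eq[OF has_derivative_diff]) (use assms in \<open>auto intro: has_derivative_dir_deriv\<close>)

lemma dir_deriv_eq_0_outside:
  assumes "closed K" "\<And>z. z \<notin> K \<Longrightarrow> f z = 0" "z \<notin> K"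
  shows "dir_deriv v f z = 0"
proof -
  have "(f has_derivative (\<lambda>_. 0)) (at z)"
    by (rule has_derivative_transform_within_open[OF has_derivative_const, of "- K"])
       (use assms in auto)
  then show ?thesis by (rule dir_deriv_eq)
qed

section \<open>Test functions\<close>

lemma test_function_iff:
  "test_function U f \<longleftrightarrow>
     smooth_on UNIV f \<and> (\<exists>K. compact K \<and> K \<subseteq> U \<and> (\<forall>z. z \<notin> K \<longrightarrow> f z = 0))"
  (is "?lhs \<longleftrightarrow> ?rhs")
proof
  assume ?lhs
  then show ?rhs
    unfolding test_function_def using closure_subset[of "{x. f x \<noteq> 0}"] by blast
next
  assume ?rhs
  then obtain K where K: "smooth_on UNIV f" "compact K" "K \<subseteq> U" "\<And>z. z \<notin> K \<Longrightarrow> f z = 0"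
    by blast
  then have "closure {x. f x \<noteq> 0} \<subseteq> K"
    by (intro closure_minimal) (auto intro: compact_imp_closed)
  moreover from this have "compact (closure {x. f x \<noteq> 0})"
    using K(2) by (metis closed_closure compact_Int_closed inf.absorb_iff2)
  ultimately show ?lhs
    using K by (auto simp: test_function_def)
qed

lemma test_function_support:
  assumes "test_function U f"
  obtains K where "compact K" "K \<subseteq> U" "\<And>z. z \<notin> K \<Longrightarrow> f z = 0"
  using assms unfolding test_function_iff by blast

lemma test_functionI:
  "smooth_on UNIV f \<Longrightarrow> compact K \<Longrightarrow> K \<subseteq> U \<Longrightarrow> (\<And>z. z \<notin> K \<Longrightarrow> f z = 0) \<Longrightarrow> test_function U f"
  unfolding test_function_iff by blast

lemma test_function_smooth: "test_function U f \<Longrightarrow> smooth_on S f"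
  unfolding test_function_def using smooth_on_subset by blast

lemma test_function_differentiable: "test_function U f \<Longrightarrow> f differentiable (at z)"
  by (rule smooth_on_differentiable[of UNIV]) (auto intro: test_function_smooth)

lemma test_function_continuous: "test_function U f \<Longrightarrow> continuous_on S f"
  by (rule smooth_on_imp_continuous_on) (rule test_function_smooth)

lemma test_function_mono: "test_function V f \<Longrightarrow> V \<subseteq> U \<Longrightarrow> test_function U f"
  by (auto simp: test_function_def)

lemma test_function_eq_0: "test_function U f \<Longrightarrow> z \<notin> U \<Longrightarrow> f z = 0"
  by (metis test_function_support subsetD)

lemma test_function_dir_deriv:
  assumes "test_function U f"
  shows "test_function U (dir_deriv v f)"
proof -
  obtain K where "compact K" "K \<subseteq> U" "\<And>z. z \<notin> K \<Longrightarrow> f z = 0"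
    by (rule test_function_support[OF assms]) blast
  then show ?thesis
    by (intro test_functionI[of _ K] smooth_on_dir_deriv test_function_smooth[OF assms])
       (auto intro: dir_deriv_eq_0_outside compact_imp_closed)
qed

text \<open>
  The product is smooth on \<open>V\<close> and vanishes on the complement of the support of \<open>f\<close>; these two open
  sets cover the whole space, so the values of \<open>g\<close> outside \<open>V\<close> do not matter.
\<close>

lemma test_function_smooth_mult:
  fixes f g :: "'a::euclidean_space \<Rightarrow> real"
  assumes "open V" "smooth_on V g" "test_function V f"
  shows "test_function V (\<lambda>z. g z * f z)"
proof -
  obtain K where K: "compact K" "K \<subseteq> V" "\<And>z. z \<notin> K \<Longrightarrow> f z = 0"
    by (rule test_function_support[OF assms(3)]) blast
  have "smooth_on V (\<lambda>z. g z * f z)"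
    by (intro smooth_on_mult assms test_function_smooth[OF assms(3)])
  moreover have "smooth_on (- K) (\<lambda>z. g z * f z)"
    by (rule smooth_on_cong[OF smooth_on_const[of _ 0]]) (use K in \<open>auto intro: compact_imp_closed\<close>)
  ultimately have "smooth_on (V \<union> - K) (\<lambda>z. g z * f z)"
    by (rule smooth_on_Un) (use assms K in \<open>auto intro: compact_imp_closed\<close>)
  moreover have "V \<union> - K = UNIV" using K by blast
  ultimately show ?thesis
    by (intro test_functionI[of _ K]) (use K in auto)
qed

text \<open>
  Outside \<open>V\<close> the derivative of \<open>g\<close> may be junk, but there every term has a factor that vanishes.
\<close>

lemma dir_deriv_smooth_mult_test_function:
  fixes f g :: "'a::euclidean_space \<Rightarrow> real"
  assumes "open V" "smooth_on V g" "test_function V f"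
  shows "dir_deriv v (\<lambda>z. g z * f z) z = g z * dir_deriv v f z + dir_deriv v g z * f z"
proof (cases "z \<in> V")
  case True
  then show ?thesis
    by (intro dir_deriv_mult smooth_on_differentiable[OF assms(2)]
        test_function_differentiable[OF assms(3)])
next
  case False
  then show ?thesis
    using test_function_eq_0[OF assms(3) False]
      test_function_eq_0[OF test_function_dir_deriv[OF assms(3)] False]
      test_function_eq_0[OF test_function_dir_deriv[OF test_function_smooth_mult[OF assms]] False]
    by simp
qed

lemma test_function_diff:
  assumes "test_function U f" "test_function U g"
  shows "test_function U (\<lambda>z. f z - g z)"
proof -
  obtain K where K: "compact K" "K \<subseteq> U" "\<And>z. z \<notin> K \<Longrightarrow> f z = 0"
    by (rule test_function_support[OF assms(1)]) blast
  obtain L where L: "compact L" "L \<subseteq> U" "\<And>z. z \<notin> L \<Longrightarrow> g z = 0"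
    by (rule test_function_support[OF assms(2)]) blast
  have "smooth_on UNIV (\<lambda>z. f z + (- g z))"
    by (intro smooth_on_add smooth_on_bounded_linear[of UNIV g uminus] bounded_linear_minus
        bounded_linear_ident assms[THEN test_function_smooth] open_UNIV)
  then show ?thesis
    by (intro test_functionI[of _ "K \<union> L"]) (use K L in auto)
qed

lemma test_function_bounded:
  assumes "test_function U f"
  obtains B where "\<And>z. \<bar>f z\<bar> \<le> B" "0 \<le> B"
proof -
  obtain K where K: "compact K" "\<And>z. z \<notin> K \<Longrightarrow> f z = 0"
    by (rule test_function_support[OF assms]) blast
  have "bounded (f ` K)"
    by (intro compact_imp_bounded compact_continuous_image test_function_continuous[OF assms] K)
  then obtain B where B: "\<And>z. z \<in> K \<Longrightarrow> \<bar>f z\<bar> \<le> B"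
    by (auto simp: bounded_iff)
  show ?thesis
  proof
    show "\<bar>f z\<bar> \<le> max B 0" for z
      using B[of z] K(2)[of z] by (cases "z \<in> K") auto
  qed simp
qed

section \<open>Local integrability and integration by parts\<close>

lemma locally_Lp_1_iff:
  "locally_Lp 1 U f \<longleftrightarrow> f \<in> borel_measurable (lebesgue_on U) \<and>
     (\<forall>K. compact K \<and> K \<subseteq> U \<longrightarrow> integrable (lebesgue_on K) f)"
proof -
  have "integrable (lebesgue_on K) (\<lambda>z. norm (f z) powr 1) \<longleftrightarrow> integrable (lebesgue_on K) f"
    if "f \<in> borel_measurable (lebesgue_on U)" "K \<subseteq> U" for K
    using measurable_restrict_mono[OF that] by (simp add: integrable_norm_iff)
  then show ?thesis
    unfolding locally_Lp_def by blast
qed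

lemma locally_Lp_1_compact:
  "locally_Lp 1 U f \<Longrightarrow> compact K \<Longrightarrow> K \<subseteq> U \<Longrightarrow> integrable (lebesgue_on K) f"
  unfolding locally_Lp_1_iff by blast

text \<open>
  The constant \<open>1\<close> is harmless on compact sets; it lets lower powers of \<open>|u|\<close> be dominated by \<open>|u|\<^sup>3\<close>.
\<close>

lemma locally_Lp_1_bound:
  assumes "f \<in> borel_measurable (lebesgue_on U)" "locally_Lp 1 U g"
    and "\<And>z. norm (f z) \<le> 1 + norm (g z)"
  shows "locally_Lp 1 U f"
  unfolding locally_Lp_1_iff
proof (intro conjI allI impI)
  fix K assume K: "compact K \<and> K \<subseteq> U"
  have "integrable (lebesgue_on K) (\<lambda>z. 1 + norm (g z))"
    using K assms(2)
    by (intro Bochner_Integration.integrable_add integrable_norm locally_Lp_1_compact[of U] finite_measure.integrable_const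
          finite_measure_lebesgue_on lmeasurable_compact) auto
  then show "integrable (lebesgue_on K) f"
    by (rule Bochner_Integration.integrable_bound)
       (use K assms(3) measurable_restrict_mono[OF assms(1)] in auto)
qed fact

lemma locally_Lp_1_add:
  "locally_Lp 1 U f \<Longrightarrow> locally_Lp 1 U g \<Longrightarrow> locally_Lp 1 U (\<lambda>z. f z + g z)"
  unfolding locally_Lp_1_iff by auto

lemma integrable_locally_Lp_mult_test_function:
  assumes "locally_Lp 1 U f" "test_function U \<phi>"
  shows "integrable lebesgue (\<lambda>z. f z * \<phi> z)"
proof -
  obtain K where K: "compact K" "K \<subseteq> U" "\<And>z. z \<notin> K \<Longrightarrow> \<phi> z = 0"
    by (rule test_function_support[OF assms(2)]) blast
  obtain B where B: "\<And>z. \<bar>\<phi> z\<bar> \<le> B" "0 \<le> B"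
    by (rule test_function_bounded[OF assms(2)]) blast
  have [measurable]: "\<phi> \<in> borel_measurable borel"
    by (intro borel_measurable_continuous_onI test_function_continuous[OF assms(2)])
  have [measurable]: "\<phi> \<in> borel_measurable lebesgue"
    by (rule measurable_completion) simp
  have int: "integrable lebesgue (\<lambda>z. indicator K z * f z)"
    using locally_Lp_1_compact[OF assms(1) K(1,2)] K(1)
    by (subst (asm) integrable_restrict_space) (auto intro: lmeasurable_compact fmeasurableD)
  have "integrable lebesgue (\<lambda>z. B * (indicator K z * f z))"
    using int by simp
  then have "integrable lebesgue (\<lambda>z. (indicator K z * f z) * \<phi> z)"
  proof (rule Bochner_Integration.integrable_bound)
    show "(\<lambda>z. (indicator K z * f z) * \<phi> z) \<in> borel_measurable lebesgue"
      using borel_measurable_integrable[OF int] by measurable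
  qed (use B in \<open>auto simp: abs_mult mult_right_mono mult.commute\<close>)
  also have "(\<lambda>z. (indicator K z * f z) * \<phi> z) = (\<lambda>z. f z * \<phi> z)"
    using K(3) by (auto simp: indicator_def fun_eq_iff)
  finally show ?thesis .
qed

lemma integrable_test_function:
  assumes "test_function U \<phi>"
  shows "integrable lebesgue \<phi>"
proof -
  have "locally_Lp 1 UNIV (\<lambda>_. 1 :: real)"
    unfolding locally_Lp_1_iff
    by (auto intro!: finite_measure.integrable_const finite_measure_lebesgue_on lmeasurable_compact)
  from integrable_locally_Lp_mult_test_function[OF this test_function_mono[OF assms subset_UNIV]]
  show ?thesis by simp
qed

lemma set_lebesgue_integral_eq_lebesgue_integral:
  fixes f :: "'a::euclidean_space \<Rightarrow> real"
  assumes "\<And>z. z \<notin> U \<Longrightarrow> f z = 0"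
  shows "(LINT z:U|lebesgue. f z) = integral\<^sup>L lebesgue f"
  unfolding set_lebesgue_integral_def
  by (rule Bochner_Integration.integral_cong) (use assms in \<open>auto simp: indicator_def\<close>)

text \<open>
  The integral of \<open>(F (z + h v) - F z) / h\<close> vanishes by translation invariance, and as \<open>h\<close> tends to
  \<open>0\<close> this difference quotient tends to the directional derivative.  The mean value theorem
  dominates it by a constant on a compact set.
\<close>

lemma integral_dir_deriv_test_function:
  fixes F :: "'a::euclidean_space \<Rightarrow> real"
  assumes F: "test_function U F"
  shows "integral\<^sup>L lebesgue (dir_deriv v F) = 0"
proof -
  obtain K where K: "compact K" "\<And>z. z \<notin> K \<Longrightarrow> F z = 0"
    by (rule test_function_support[OF F]) blast
  obtain B where B: "\<And>z. \<bar>dir_deriv v F z\<bar> \<le> B" "0 \<le> B"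
    by (rule test_function_bounded[OF test_function_dir_deriv[OF F]]) blast
  have [measurable]: "F \<in> borel_measurable borel" "dir_deriv v F \<in> borel_measurable borel"
    by (intro borel_measurable_continuous_onI test_function_continuous[of U] test_function_dir_deriv F)+
  \<comment> \<open>Every segment from \<open>z\<close> to \<open>z + v\<close> that meets \<open>K\<close> starts in \<open>K'\<close>.\<close>
  define K' where "K' = (\<lambda>(x, s). x - s *\<^sub>R v) ` (K \<times> {0..1})"
  have K': "compact K'"
    unfolding K'_def
    by (intro compact_continuous_image compact_Times K compact_Icc)
       (auto intro!: continuous_intros simp: case_prod_unfold)
  have in_K': "z \<in> K'" if "z + s *\<^sub>R v \<in> K" "0 \<le> s" "s \<le> 1" for z s
    unfolding K'_def by (rule image_eqI[of _ _ "(z + s *\<^sub>R v, s)"]) (use that in auto)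
  have line: "((\<lambda>s. F (z + s *\<^sub>R v)) has_real_derivative dir_deriv v F (z + s *\<^sub>R v)) (at s)" for z s
  proof -
    have "((\<lambda>s. F (z + s *\<^sub>R v)) has_derivative (\<lambda>h. dir_deriv (h *\<^sub>R v) F (z + s *\<^sub>R v))) (at s)"
      by (rule has_derivative_compose[OF _ has_derivative_dir_deriv[OF test_function_differentiable[OF F]]])
         (auto intro!: derivative_eq_intros)
    moreover have "(\<lambda>h. dir_deriv (h *\<^sub>R v) F w) = (*) (dir_deriv v F w)" for w
      using linear_scale[OF has_derivative_linear[OF has_derivative_dir_deriv[OF
          test_function_differentiable[OF F]]]] by (auto simp: mult.commute)
    ultimately show ?thesis
      by (simp add: has_field_derivative_def)
  qed
  define h where "h n = inverse (real (Suc n))" for n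
  have h: "0 < h n" "h n \<le> 1" for n
    by (auto simp: h_def field_simps)
  define D where "D n z = (F (z + h n *\<^sub>R v) - F z) / h n" for n z
  have D_le: "norm (D n z) \<le> B * indicator K' z" for n z
  proof (cases "z \<in> K'")
    case True
    obtain s where "0 < s" "s < h n"
      "F (z + h n *\<^sub>R v) - F (z + 0 *\<^sub>R v) = (h n - 0) * dir_deriv v F (z + s *\<^sub>R v)"
      using MVT2[OF h(1)[of n], of "\<lambda>s. F (z + s *\<^sub>R v)" "\<lambda>s. dir_deriv v F (z + s *\<^sub>R v)"] line by blast
    then have "D n z = dir_deriv v F (z + s *\<^sub>R v)"
      using h(1)[of n] by (simp add: D_def)
    then show ?thesis using B True by simp
  next
    case False
    then have "F z = 0" "F (z + h n *\<^sub>R v) = 0"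
      using in_K'[of z 0] in_K'[of z "h n"] K(2) h[of n] by auto
    then show ?thesis using False by (simp add: D_def)
  qed
  have int0: "integral\<^sup>L lborel (D n) = 0" for n
  proof -
    have iF: "integrable lborel F"
      using integrable_test_function[OF F] by (simp add: integrable_completion)
    have iF': "integrable lborel (\<lambda>z. F (h n *\<^sub>R v + z))"
      and eq: "integral\<^sup>L lborel (\<lambda>z. F (h n *\<^sub>R v + z)) = integral\<^sup>L lborel F"
      using iF integrable_distr_eq[of "(+) (h n *\<^sub>R v)" lborel borel F]
        integral_distr[of "(+) (h n *\<^sub>R v)" lborel borel F]
      by (auto simp: lborel_distr_plus)
    show ?thesis
      using iF iF' eq by (simp add: D_def[abs_def] add.commute)
  qed
  have "(\<lambda>n. integral\<^sup>L lborel (D n)) \<longlonglongrightarrow> integral\<^sup>L lborel (dir_deriv v F)"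
  proof (rule integral_dominated_convergence)
    show "integrable lborel (\<lambda>z. B * indicator K' z)"
      using K' by (auto intro!: integrable_real_indicator emeasure_bounded_finite compact_imp_bounded
          simp: borel_compact)
    show "AE z in lborel. (\<lambda>n. D n z) \<longlonglongrightarrow> dir_deriv v F z"
    proof (rule AE_I2)
      fix z
      have "((\<lambda>s. (F (z + s *\<^sub>R v) - F z) / s) \<longlongrightarrow> dir_deriv v F z) (at 0)"
        using line[of z 0] by (simp add: DERIV_def)
      moreover have "filterlim h (at 0) sequentially"
        unfolding filterlim_at using h(1) LIMSEQ_inverse_real_of_nat
        by (auto simp: h_def[abs_def] intro!: always_eventually)
      ultimately show "(\<lambda>n. D n z) \<longlonglongrightarrow> dir_deriv v F z"
        unfolding D_def by (rule filterlim_compose)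
    qed
    show "D n \<in> borel_measurable lborel" for n unfolding D_def[abs_def] by measurable
  qed (use D_le in auto)
  then have "integral\<^sup>L lborel (dir_deriv v F) = 0"
    unfolding int0 by (simp add: LIMSEQ_const_iff)
  then show ?thesis by (simp add: integral_completion)
qed

section \<open>The energy equality where the velocity is smooth\<close>

abbreviation dt :: "(spacetime \<Rightarrow> real) \<Rightarrow> spacetime \<Rightarrow> real" where
  "dt \<equiv> dir_deriv (0, 1)"

abbreviation dx :: "3 \<Rightarrow> (spacetime \<Rightarrow> real) \<Rightarrow> spacetime \<Rightarrow> real" where
  "dx i \<equiv> dir_deriv (axis i 1, 0)"

lemma time_deriv_eq_dt: "time_deriv f = dt f"
  by (auto simp: time_deriv_def dir_deriv_def)

lemma space_grad_nth: "space_grad f z $ i = dx i f z"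
  by (simp add: space_grad_def dir_deriv_def)

lemma inner_space_grad: "a \<bullet> space_grad f z = (\<Sum>i\<in>UNIV. a $ i * dx i f z)"
  by (simp add: inner_vec_def space_grad_nth)

lemma locally_Lp_energy_flux:
  assumes "euler_weak_solution U u p"
  shows "locally_Lp 1 U (\<lambda>z. 1/2 * (norm (u z))\<^sup>2)"
    and "locally_Lp 1 U (\<lambda>z. (1/2 * (norm (u z))\<^sup>2 + p z) * u z $ i)"
proof -
  have u: "locally_Lp 3 U u" and pu: "locally_Lp 1 U (\<lambda>z. p z *\<^sub>R u z)"
    using assms by (auto simp: euler_weak_solution_def)
  have [measurable]: "u \<in> borel_measurable (lebesgue_on U)"
    using u by (simp add: locally_Lp_def)
  have [measurable]: "(\<lambda>z. u z $ i) \<in> borel_measurable (lebesgue_on U)"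
    by (rule measurable_compose[of u _ borel])
       (auto intro!: borel_measurable_continuous_onI continuous_intros)
  have u3: "locally_Lp 1 U (\<lambda>z. norm (u z) ^ 3)"
    using u unfolding locally_Lp_def by (auto simp: powr_numeral)
  have sq_le: "1/2 * x\<^sup>2 \<le> 1 + x ^ 3" if "0 \<le> x" for x :: real
  proof (cases "x \<le> 1")
    case True
    then have "x\<^sup>2 \<le> 1" using that by (simp add: power_le_one)
    moreover have "0 \<le> x ^ 3" using that by simp
    ultimately show ?thesis by linarith
  next
    case False
    then have "x\<^sup>2 \<le> x ^ 3" by (intro power_increasing) auto
    then show ?thesis using zero_le_power2[of x] by linarith
  qed
  show "locally_Lp 1 U (\<lambda>z. 1/2 * (norm (u z))\<^sup>2)"
  proof (rule locally_Lp_1_bound[OF _ u3])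
    show "norm (1/2 * (norm (u z))\<^sup>2) \<le> 1 + norm (norm (u z) ^ 3)" for z
      using sq_le[of "norm (u z)"] by simp
  qed measurable
  have "locally_Lp 1 U (\<lambda>z. 1/2 * (norm (u z))\<^sup>2 * u z $ i)"
  proof (rule locally_Lp_1_bound[OF _ u3])
    have "\<bar>u z $ i\<bar> * (norm (u z))\<^sup>2 \<le> norm (u z) ^ 3" for z
      using mult_right_mono[OF component_le_norm_cart[of "u z" i], of "(norm (u z))\<^sup>2"]
      by (simp add: power3_eq_cube power2_eq_square mult.assoc)
    moreover have "0 \<le> norm (u z) ^ 3" for z by simp
    ultimately have "\<bar>u z $ i\<bar> * (norm (u z))\<^sup>2 \<le> 2 + 2 * norm (u z) ^ 3" for z
      by (smt (verit))
    then show "norm (1/2 * (norm (u z))\<^sup>2 * u z $ i) \<le> 1 + norm (norm (u z) ^ 3)" for z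
      by (simp add: abs_mult mult.commute)
  qed measurable
  moreover have "locally_Lp 1 U (\<lambda>z. p z * u z $ i)"
    unfolding locally_Lp_1_iff
  proof (intro conjI allI impI)
    have "(\<lambda>z. (p z *\<^sub>R u z) $ i) \<in> borel_measurable (lebesgue_on U)"
      by (rule measurable_compose[of "\<lambda>z. p z *\<^sub>R u z" _ borel])
         (use pu in \<open>auto simp: locally_Lp_1_iff intro!: borel_measurable_continuous_onI continuous_intros\<close>)
    then show "(\<lambda>z. p z * u z $ i) \<in> borel_measurable (lebesgue_on U)" by simp
    show "integrable (lebesgue_on K) (\<lambda>z. p z * u z $ i)" if "compact K \<and> K \<subseteq> U" for K
      using integrable_bounded_linear[OF bounded_linear_vec_nth[of i] locally_Lp_1_compact[OF pu, of K]] that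
      by simp
  qed
  ultimately show "locally_Lp 1 U (\<lambda>z. (1/2 * (norm (u z))\<^sup>2 + p z) * u z $ i)"
    unfolding distrib_right by (rule locally_Lp_1_add)
qed

text \<open>
  A single integrand over the whole space, linear in the derivatives of \<open>\<phi>\<close>, is what the arguments
  below manipulate.
\<close>

lemma
  assumes "euler_weak_solution U u p" "test_function U \<phi>"
  shows integrable_energy_density:
      "integrable lebesgue (\<lambda>z. 1/2 * (norm (u z))\<^sup>2 * dt \<phi> z +
        (\<Sum>i\<in>UNIV. (1/2 * (norm (u z))\<^sup>2 + p z) * u z $ i * dx i \<phi> z))"
    and local_energy_eq_integral:
      "local_energy U u p \<phi> = (LINT z|lebesgue. 1/2 * (norm (u z))\<^sup>2 * dt \<phi> z +
        (\<Sum>i\<in>UNIV. (1/2 * (norm (u z))\<^sup>2 + p z) * u z $ i * dx i \<phi> z))"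
proof -
  have i1: "integrable lebesgue (\<lambda>z. 1/2 * (norm (u z))\<^sup>2 * dt \<phi> z)"
    by (intro integrable_locally_Lp_mult_test_function[of U] locally_Lp_energy_flux[OF assms(1)]
        test_function_dir_deriv assms)
  have i2: "integrable lebesgue (\<lambda>z. \<Sum>i\<in>UNIV. (1/2 * (norm (u z))\<^sup>2 + p z) * u z $ i * dx i \<phi> z)"
    by (intro Bochner_Integration.integrable_sum integrable_locally_Lp_mult_test_function[of U]
        locally_Lp_energy_flux[OF assms(1)] test_function_dir_deriv assms)
  show "integrable lebesgue (\<lambda>z. 1/2 * (norm (u z))\<^sup>2 * dt \<phi> z +
        (\<Sum>i\<in>UNIV. (1/2 * (norm (u z))\<^sup>2 + p z) * u z $ i * dx i \<phi> z))"
    using i1 i2 by (rule Bochner_Integration.integrable_add)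
  have z: "dir_deriv v \<phi> z = 0" if "z \<notin> U" for z v
    by (rule test_function_eq_0[OF test_function_dir_deriv[OF assms(2)] that])
  have "local_energy U u p \<phi> = (LINT z|lebesgue. 1/2 * (norm (u z))\<^sup>2 * dt \<phi> z) +
      (LINT z|lebesgue. (\<Sum>i\<in>UNIV. (1/2 * (norm (u z))\<^sup>2 + p z) * u z $ i * dx i \<phi> z))"
    unfolding local_energy_def time_deriv_eq_dt inner_space_grad sum_distrib_left mult.assoc[symmetric]
    using z by (intro arg_cong2[where f = "(+)"] set_lebesgue_integral_eq_lebesgue_integral) auto
  also have "\<dots> = (LINT z|lebesgue. 1/2 * (norm (u z))\<^sup>2 * dt \<phi> z +
        (\<Sum>i\<in>UNIV. (1/2 * (norm (u z))\<^sup>2 + p z) * u z $ i * dx i \<phi> z))"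
    by (rule Bochner_Integration.integral_add[OF i1 i2, symmetric])
  finally show "local_energy U u p \<phi> = (LINT z|lebesgue. 1/2 * (norm (u z))\<^sup>2 * dt \<phi> z +
        (\<Sum>i\<in>UNIV. (1/2 * (norm (u z))\<^sup>2 + p z) * u z $ i * dx i \<phi> z))" .
qed

lemma local_energy_diff:
  assumes "euler_weak_solution U u p" "test_function U \<phi>" "test_function U \<xi>"
  shows "local_energy U u p (\<lambda>z. \<phi> z - \<xi> z) = local_energy U u p \<phi> - local_energy U u p \<xi>"
proof -
  have d: "dir_deriv v (\<lambda>z. \<phi> z - \<xi> z) z = dir_deriv v \<phi> z - dir_deriv v \<xi> z" for v z
    by (intro dir_deriv_diff test_function_differentiable[OF assms(2)]
        test_function_differentiable[OF assms(3)])
  show ?thesis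
    unfolding local_energy_eq_integral[OF assms(1,2)] local_energy_eq_integral[OF assms(1,3)]
      local_energy_eq_integral[OF assms(1) test_function_diff[OF assms(2,3)]]
    by (subst Bochner_Integration.integral_diff[OF integrable_energy_density[OF assms(1,2)]
          integrable_energy_density[OF assms(1,3)], symmetric])
       (simp add: d right_diff_distrib sum_subtractf algebra_simps)
qed

text \<open>
  The weak form of \<open>div u = 0\<close> is tested with \<open>\<xi> = (div u) \<phi>\<^sup>2\<close>.  Integration by parts turns it into
  \<open>\<integral> ((div u) \<phi>)\<^sup>2 = 0\<close>.
\<close>

lemma AE_divergence_mult_test_function_eq_0:
  assumes sol: "euler_weak_solution U u p" and V: "open V" "V \<subseteq> U" "smooth_on V u"
    and \<phi>: "test_function V \<phi>"
  shows "AE z in lebesgue. (\<Sum>i\<in>UNIV. dx i (\<lambda>z. u z $ i) z) * \<phi> z = 0"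
proof -
  define d where "d z = (\<Sum>i\<in>UNIV. dx i (\<lambda>z. u z $ i) z)" for z
  have ui: "smooth_on V (\<lambda>z. u z $ i)" for i
    by (intro smooth_on_bounded_linear[OF V(3,1)] bounded_linear_vec_nth)
  have d: "smooth_on V d"
    unfolding d_def[abs_def] by (intro smooth_on_sum smooth_on_dir_deriv ui V)
  define \<xi> where "\<xi> z = d z * (\<phi> z * \<phi> z)" for z
  have \<xi>: "test_function V \<xi>"
    unfolding \<xi>_def[abs_def]
    by (intro test_function_smooth_mult V d \<phi> test_function_smooth[OF \<phi>])
  have int1: "integrable lebesgue (\<lambda>z. u z $ i * dx i \<xi> z)" for i
    by (rule integrable_test_function[OF test_function_smooth_mult[OF V(1) ui test_function_dir_deriv[OF \<xi>]]])
  have int2: "integrable lebesgue (\<lambda>z. d z * \<xi> z)"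
    by (rule integrable_test_function[OF test_function_smooth_mult[OF V(1) d \<xi>]])
  have int3: "integrable lebesgue (dx i (\<lambda>z. u z $ i * \<xi> z))" for i
    by (rule integrable_test_function[OF test_function_dir_deriv[OF test_function_smooth_mult[OF V(1) ui \<xi>]]])
  have "(LINT z:U|lebesgue. u z \<bullet> space_grad \<xi> z) = 0"
    using sol test_function_mono[OF \<xi> V(2)] by (auto simp: euler_weak_solution_def)
  then have "(LINT z|lebesgue. (\<Sum>i\<in>UNIV. u z $ i * dx i \<xi> z)) = 0"
    unfolding inner_space_grad
    using test_function_eq_0[OF test_function_dir_deriv[OF test_function_mono[OF \<xi> V(2)]]]
    by (subst (asm) set_lebesgue_integral_eq_lebesgue_integral) auto
  moreover have "(LINT z|lebesgue. (\<Sum>i\<in>UNIV. dx i (\<lambda>z. u z $ i * \<xi> z) z)) = 0"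
    by (subst Bochner_Integration.integral_sum[OF int3])
       (simp add: integral_dir_deriv_test_function[OF test_function_smooth_mult[OF V(1) ui \<xi>]])
  moreover have "d z * \<xi> z = (\<Sum>i\<in>UNIV. dx i (\<lambda>z. u z $ i * \<xi> z) z) - (\<Sum>i\<in>UNIV. u z $ i * dx i \<xi> z)" for z
    by (simp add: d_def dir_deriv_smooth_mult_test_function[OF V(1) ui \<xi>] sum.distrib sum_distrib_right)
  ultimately have "(LINT z|lebesgue. d z * \<xi> z) = 0"
    by (simp add: Bochner_Integration.integral_diff int1 int3)
  moreover have sq: "d z * \<xi> z = (d z * \<phi> z)\<^sup>2" for z
    by (simp add: \<xi>_def power2_eq_square)
  ultimately have "AE z in lebesgue. (d z * \<phi> z)\<^sup>2 = 0"
    using integral_nonneg_eq_0_iff_AE[OF int2] by simp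
  then show ?thesis by (simp add: d_def)
qed

text \<open>
  With \<open>e = |u|\<^sup>2 / 2\<close>, the integrands \<open>M i\<close> of the momentum equation tested with \<open>u\<^sub>i \<phi>\<close> add up to
  \<open>L + \<partial>\<^sub>t (e \<phi>) + div (e u \<phi>) + (p - e) (div u) \<phi>\<close>, where \<open>L\<close> is the energy density of \<open>\<phi>\<close>.  The
  integrals of the two middle terms vanish because \<open>e \<phi>\<close> and \<open>e u\<^sub>j \<phi>\<close> are test functions, and the
  last term is zero almost everywhere.
\<close>

lemma local_energy_eq_0_of_smooth:
  assumes sol: "euler_weak_solution U u p" and V: "open V" "V \<subseteq> U" "smooth_on V u"
    and \<phi>: "test_function V \<phi>"
  shows "local_energy U u p \<phi> = 0"
proof -
  note \<phi>U = test_function_mono[OF \<phi> V(2)]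
  define w where "w i z = u z $ i" for i z
  have w: "smooth_on V (w i)" for i
    unfolding w_def[abs_def] by (intro smooth_on_bounded_linear[OF V(3,1)] bounded_linear_vec_nth)
  define e where "e z = (\<Sum>i\<in>UNIV. 1/2 * (w i z * w i z))" for z
  have e_eq: "1/2 * (norm (u z))\<^sup>2 = e z" for z
    by (simp add: e_def w_def power2_norm_eq_inner inner_vec_def sum_distrib_left)
  have e: "smooth_on V e"
    unfolding e_def[abs_def] by (intro smooth_on_sum smooth_on_mult smooth_on_const w V)
  have dw: "w i differentiable (at z)" if "z \<in> V" for i z
    by (rule smooth_on_differentiable[OF w that])
  have de: "dir_deriv v e z = (\<Sum>i\<in>UNIV. w i z * dir_deriv v (w i) z)" if "z \<in> V" for v z
  proof -
    have "(e has_derivative (\<lambda>h. \<Sum>i\<in>UNIV. 1/2 * (w i z * dir_deriv h (w i) z + dir_deriv h (w i) z * w i z))) (at z)"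
      unfolding e_def[abs_def]
      by (intro has_derivative_sum has_derivative_mult_right has_derivative_mult
          has_derivative_dir_deriv dw that)
    from dir_deriv_eq[OF this] show ?thesis by (simp add: mult.commute)
  qed
  have W: "test_function V (\<lambda>z. w i z * \<phi> z)" for i
    by (rule test_function_smooth_mult[OF V(1) w \<phi>])
  define M where "M i z = w i z * dt (\<lambda>z. w i z * \<phi> z) z +
      (\<Sum>j\<in>UNIV. w i z * (w j z * dx j (\<lambda>z. w i z * \<phi> z) z)) + p z * dx i (\<lambda>z. w i z * \<phi> z) z" for i z
  have p: "locally_Lp 1 U p" using sol by (simp add: euler_weak_solution_def)
  have intM: "integrable lebesgue (M i)" for i
    unfolding M_def[abs_def]
    by (intro Bochner_Integration.integrable_add Bochner_Integration.integrable_sum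
        integrable_locally_Lp_mult_test_function[OF p] integrable_test_function[of V]
        test_function_smooth_mult V w test_function_dir_deriv W test_function_mono[OF _ V(2)])
  have M0: "integral\<^sup>L lebesgue (M i) = 0" for i
  proof -
    have "(LINT z:U|lebesgue. M i z) = 0"
      using sol test_function_mono[OF W V(2), of i]
      unfolding euler_weak_solution_def time_deriv_eq_dt inner_space_grad space_grad_nth M_def
        sum_distrib_left w_def by blast
    moreover have "M i z = 0" if "z \<notin> U" for z
      using test_function_eq_0[OF test_function_dir_deriv[OF test_function_mono[OF W V(2)]] that]
      by (simp add: M_def)
    ultimately show ?thesis
      by (subst (asm) set_lebesgue_integral_eq_lebesgue_integral) auto
  qed
  define L where "L z = e z * dt \<phi> z + (\<Sum>j\<in>UNIV. (e z + p z) * w j z * dx j \<phi> z)" for z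
  have intL: "integrable lebesgue L" and L: "local_energy U u p \<phi> = integral\<^sup>L lebesgue L"
    using integrable_energy_density[OF sol \<phi>U] local_energy_eq_integral[OF sol \<phi>U]
    unfolding e_eq by (simp_all add: L_def[abs_def] w_def)
  define D where "D z = dt (\<lambda>z. e z * \<phi> z) z + (\<Sum>j\<in>UNIV. dx j (\<lambda>z. (e z * w j z) * \<phi> z) z)" for z
  have ew: "smooth_on V (\<lambda>z. e z * w j z)" for j by (intro smooth_on_mult e w V)
  have tD: "test_function V (\<lambda>z. e z * \<phi> z)" "test_function V (\<lambda>z. (e z * w j z) * \<phi> z)" for j
    by (intro test_function_smooth_mult V e ew \<phi>)+
  have intD: "integrable lebesgue D"
    unfolding D_def[abs_def]
    by (intro Bochner_Integration.integrable_add Bochner_Integration.integrable_sum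
        integrable_test_function[of V] test_function_dir_deriv tD)
  have D0: "integral\<^sup>L lebesgue D = 0"
    unfolding D_def[abs_def]
    by (subst Bochner_Integration.integral_add Bochner_Integration.integral_sum;
        (intro Bochner_Integration.integrable_sum integrable_test_function[of V] test_function_dir_deriv tD)?)+
       (simp add: integral_dir_deriv_test_function[OF tD(1)] integral_dir_deriv_test_function[OF tD(2)])
  have pointwise: "(\<Sum>i\<in>UNIV. M i z) = L z + D z + (p z - e z) * ((\<Sum>i\<in>UNIV. dx i (w i) z) * \<phi> z)" for z
  proof (cases "z \<in> V")
    case True
    have dew: "dir_deriv v (\<lambda>z. e z * w j z) z = e z * dir_deriv v (w j) z + dir_deriv v e z * w j z" for v j
      by (intro dir_deriv_mult smooth_on_differentiable[OF e True] dw True)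
    show ?thesis
      unfolding M_def L_def D_def dir_deriv_smooth_mult_test_function[OF V(1) w \<phi>]
        dir_deriv_smooth_mult_test_function[OF V(1) e \<phi>] dir_deriv_smooth_mult_test_function[OF V(1) ew \<phi>]
        dew de[OF True]
      unfolding e_def sum_3
      by (simp add: field_simps)
  next
    case False
    have z: "\<phi> z = 0" "dir_deriv v \<phi> z = 0" "dir_deriv v (\<lambda>z. w i z * \<phi> z) z = 0"
      "dir_deriv v (\<lambda>z. e z * \<phi> z) z = 0" "dir_deriv v (\<lambda>z. (e z * w j z) * \<phi> z) z = 0" for v i j
      by (intro test_function_eq_0[OF _ False] test_function_dir_deriv \<phi> W tD)+
    show ?thesis unfolding M_def L_def D_def z by simp
  qed
  have "0 = (LINT z|lebesgue. (\<Sum>i\<in>UNIV. M i z))"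
    by (simp add: Bochner_Integration.integral_sum intM M0)
  also have "\<dots> = (LINT z|lebesgue. L z + D z)"
  proof (rule integral_cong_AE)
    have "AE z in lebesgue. (\<Sum>i\<in>UNIV. dx i (w i) z) * \<phi> z = 0"
      using AE_divergence_mult_test_function_eq_0[OF assms] by (simp add: w_def[abs_def])
    then show "AE z in lebesgue. (\<Sum>i\<in>UNIV. M i z) = L z + D z"
      by eventually_elim (simp add: pointwise)
  qed (use intM intL intD in \<open>auto intro!: borel_measurable_integrable\<close>)
  also have "\<dots> = local_energy U u p \<phi>"
    by (simp add: intL intD D0 L)
  finally show ?thesis by simp
qed

section \<open>Cut-offs around the singularity\<close>

lemma test_function_cutoff:
  assumes "time_cutoff T \<delta> C0 \<eta>" "space_cutoff \<rho> (\<psi> \<rho>)" "\<rho> \<le> R"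
  shows "test_function (cylinder R T) (cutoff \<eta> \<psi> \<rho>)"
proof -
  have \<psi>: "test_function (ball 0 (2 * \<rho>)) (\<psi> \<rho>)" and \<eta>: "test_function {0<..<2 * T} \<eta>"
    using assms by (auto simp: space_cutoff_def time_cutoff_def)
  obtain K where K: "compact K" "K \<subseteq> ball 0 (2 * \<rho>)" "\<And>x. x \<notin> K \<Longrightarrow> \<psi> \<rho> x = 0"
    by (rule test_function_support[OF \<psi>]) blast
  obtain L where L: "compact L" "L \<subseteq> {0<..<2 * T}" "\<And>t. t \<notin> L \<Longrightarrow> \<eta> t = 0"
    by (rule test_function_support[OF \<eta>]) blast
  have "smooth_on UNIV (\<lambda>z :: spacetime. \<eta> (snd z) * \<psi> \<rho> (fst z))"
    by (rule smooth_on_mult[OF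
          smooth_on_compose_bounded_linear[OF test_function_smooth[OF \<eta>] bounded_linear_snd]
          smooth_on_compose_bounded_linear[OF test_function_smooth[OF \<psi>] bounded_linear_fst]
          open_UNIV])
  then have "smooth_on UNIV (cutoff \<eta> \<psi> \<rho>)"
    by (simp add: cutoff_def case_prod_unfold)
  moreover have "ball 0 (2 * \<rho>) \<subseteq> (ball 0 (2 * R) :: (real^3) set)"
    using assms(3) by (intro subset_ball) simp
  ultimately show ?thesis
    by (intro test_functionI[of _ "K \<times> L"] compact_Times K(1) L(1))
       (use K(2,3) L(2,3) in \<open>force simp: cylinder_def cutoff_def\<close>)+
qed

text \<open>
  Both space cut-offs equal \<open>1\<close> on the ball of radius \<open>r = min \<rho> \<sigma>\<close>, so the cylinder over that ball can
  be cut out of the support of the difference.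
\<close>

lemma test_function_cutoff_diff_punctured:
  assumes "time_cutoff T \<delta> C0 \<eta>" "space_cutoff \<rho> (\<psi> \<rho>)" "space_cutoff \<sigma> (\<psi> \<sigma>)"
    and "0 < \<rho>" "\<rho> \<le> R" "0 < \<sigma>" "\<sigma> \<le> R"
  shows "test_function ((ball 0 (2 * R) - {0}) \<times> {0<..<2 * T}) (\<lambda>z. cutoff \<eta> \<psi> \<rho> z - cutoff \<eta> \<psi> \<sigma> z)"
proof -
  have "test_function (cylinder R T) (\<lambda>z. cutoff \<eta> \<psi> \<rho> z - cutoff \<eta> \<psi> \<sigma> z)"
    by (intro test_function_diff test_function_cutoff[where \<psi> = \<psi>, OF assms(1)] assms(2,3,5,7))
  then obtain K where sm: "smooth_on UNIV (\<lambda>z. cutoff \<eta> \<psi> \<rho> z - cutoff \<eta> \<psi> \<sigma> z)"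
    and K: "compact K" "K \<subseteq> cylinder R T" "\<And>z. z \<notin> K \<Longrightarrow> cutoff \<eta> \<psi> \<rho> z - cutoff \<eta> \<psi> \<sigma> z = 0"
    unfolding test_function_iff by blast
  define r where "r = min \<rho> \<sigma>"
  have r: "0 < r" using assms by (simp add: r_def)
  have eq: "cutoff \<eta> \<psi> \<rho> z = cutoff \<eta> \<psi> \<sigma> z" if "z \<in> ball 0 r \<times> UNIV" for z
    using that assms(2,3) by (auto simp: cutoff_def space_cutoff_def r_def)
  show ?thesis
  proof (rule test_functionI[OF sm, of "K - ball 0 r \<times> UNIV"])
    show "compact (K - ball 0 r \<times> UNIV)"
      by (intro compact_diff K open_Times) auto
    show "K - ball 0 r \<times> UNIV \<subseteq> (ball 0 (2 * R) - {0}) \<times> {0<..<2 * T}"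
      using K(2) r by (auto simp: cylinder_def)
    show "cutoff \<eta> \<psi> \<rho> z - cutoff \<eta> \<psi> \<sigma> z = 0" if "z \<notin> K - ball 0 r \<times> UNIV" for z
      using that K(3)[of z] eq[of z] by auto
  qed
qed

text \<open>
  The dissipation is concentrated at the singularity \<open>x = 0\<close>, near which the cut-offs of all radii
  coincide.
\<close>

lemma anomalous_dissipation_scale_invariant:
  assumes "euler_weak_solution (cylinder R T) u p"
    and "smooth_on ((ball 0 (2 * R) - {0}) \<times> {0<..<2 * T}) u"
    and "time_cutoff T \<delta> C0 \<eta>"
    and "\<And>\<rho>. 0 < \<rho> \<Longrightarrow> \<rho> \<le> R \<Longrightarrow> space_cutoff \<rho> (\<psi> \<rho>)"
    and "0 < \<rho>" "\<rho> \<le> R" "0 < \<sigma>" "\<sigma> \<le> R"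
  shows "anomalous_dissipation R T u p \<eta> \<psi> \<rho> = anomalous_dissipation R T u p \<eta> \<psi> \<sigma>"
proof -
  have "local_energy (cylinder R T) u p (\<lambda>z. cutoff \<eta> \<psi> \<rho> z - cutoff \<eta> \<psi> \<sigma> z) = 0"
  proof (rule local_energy_eq_0_of_smooth[OF assms(1)])
    show "test_function ((ball 0 (2 * R) - {0}) \<times> {0<..<2 * T}) (\<lambda>z. cutoff \<eta> \<psi> \<rho> z - cutoff \<eta> \<psi> \<sigma> z)"
      by (rule test_function_cutoff_diff_punctured[OF assms(3)]) (use assms in auto)
  qed (use assms(2) in \<open>auto simp: cylinder_def intro!: open_Times open_Diff\<close>)
  then show ?thesis
    by (simp add: anomalous_dissipation_def local_energy_diff[OF assms(1)
          test_function_cutoff[where \<psi> = \<psi>, OF assms(3) assms(4)[OF assms(5,6)] assms(6)]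
          test_function_cutoff[where \<psi> = \<psi>, OF assms(3) assms(4)[OF assms(7,8)] assms(8)]])
qed

lemma AE_lebesgue_fst_neq_0: "AE z in lebesgue. fst (z :: spacetime) \<noteq> 0"
proof -
  have "negligible {z :: spacetime. (axis 1 1, 0) \<bullet> z = 0}"
    by (rule negligible_hyperplane) (simp add: zero_prod_def)
  then have "AE z in lebesgue. z \<notin> {z :: spacetime. (axis 1 1, 0) \<bullet> z = 0}"
    by (intro AE_not_in) (simp add: negligible_iff_null_sets)
  then show ?thesis
    by eventually_elim auto
qed

text \<open>
  The weight is at most \<open>1\<close> and vanishes outside the cylinder of radius \<open>2 \<rho>\<close>, so the integral is
  bounded by the energy in that cylinder, uniformly in the choice of \<open>\<psi> \<rho>\<close>.  Dominated convergence
  along the cylinders of radius \<open>h n\<close>, which shrink to the null set \<open>x = 0\<close>, makes this bound small.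
\<close>

lemma weighted_energy_small:
  assumes sol: "euler_weak_solution (cylinder R T) u p"
    and \<eta>: "time_cutoff T \<delta> C0 \<eta>"
    and \<psi>: "\<And>\<rho>. 0 < \<rho> \<Longrightarrow> \<rho> \<le> R \<Longrightarrow> space_cutoff \<rho> (\<psi> \<rho>)"
    and "0 < R" "0 < \<delta>" "0 < (m :: real)"
  obtains r where "0 < r" "r \<le> R"
    "\<And>\<rho>. 0 < \<rho> \<Longrightarrow> \<rho> \<le> r \<Longrightarrow>
       (LINT z:cylinder R T|lebesgue. 1/2 * (norm (u z))\<^sup>2 * (cutoff \<eta> \<psi> \<rho> z powr \<delta>)) < m"
proof -
  obtain L where L: "compact L" "L \<subseteq> {0<..<2 * T}" "\<And>t. t \<notin> L \<Longrightarrow> \<eta> t = 0"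
    by (rule test_function_support[of "{0<..<2 * T}" \<eta>]) (use \<eta> in \<open>auto simp: time_cutoff_def\<close>)
  define K where "K = (cball 0 R \<times> L :: spacetime set)"
  have K: "compact K" "K \<subseteq> cylinder R T"
    unfolding K_def using L \<open>0 < R\<close> by (auto simp: cylinder_def intro: compact_Times)
  define w where "w z = indicator K z * (1/2 * (norm (u z))\<^sup>2)" for z
  have w: "integrable lebesgue w"
    using locally_Lp_1_compact[OF locally_Lp_energy_flux(1)[OF sol] K] K(1) unfolding w_def[abs_def]
    by (subst (asm) integrable_restrict_space) (auto intro: lmeasurable_compact fmeasurableD)
  define h where "h n = R / real (Suc n)" for n
  have h: "0 < h n" "h n \<le> R" for n
    using \<open>0 < R\<close> by (auto simp: h_def field_simps)
  define S where "S n = (ball 0 (h n) \<times> UNIV :: spacetime set)" for n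
  have S: "S n \<in> sets lebesgue" for n
    unfolding S_def by (intro sets_completionI_sets borel_open[THEN subsetD[OF equalityD1[OF sets_lborel[symmetric]]]] open_Times) auto
  have wS: "integrable lebesgue (\<lambda>z. w z * indicator (S n) z)" for n
    by (rule integrable_real_mult_indicator[OF S w])
  have "(\<lambda>n. LINT z|lebesgue. w z * indicator (S n) z) \<longlonglongrightarrow> (LINT z :: spacetime|lebesgue. (0 :: real))"
  proof (rule integral_dominated_convergence[where w = w and f = "\<lambda>_. 0"])
    show "integrable lebesgue w" by (rule w)
    show "AE z in lebesgue. (\<lambda>n. w z * indicator (S n) z) \<longlonglongrightarrow> 0"
      using AE_lebesgue_fst_neq_0
    proof eventually_elim
      case (elim z)
      have "h \<longlonglongrightarrow> 0"
        unfolding h_def[abs_def] by (rule real_tendsto_divide_at_top[OF tendsto_const])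
          (intro filterlim_compose[OF filterlim_real_sequentially filterlim_Suc])
      then have "\<forall>\<^sub>F n in sequentially. h n < norm (fst z)"
        by (rule order_tendstoD) (use elim in simp)
      then have "\<forall>\<^sub>F n in sequentially. 0 = w z * indicator (S n) z"
        by eventually_elim (auto simp: S_def indicator_def mem_Times_iff)
      then show ?case by (rule Lim_transform_eventually[OF tendsto_const])
    qed
    show "AE z in lebesgue. norm (w z * indicator (S n) z) \<le> w z" for n
      by (rule AE_I2) (auto simp: w_def indicator_def)
  qed (use w wS in auto)
  then have "\<forall>\<^sub>F n in sequentially. (LINT z|lebesgue. w z * indicator (S n) z) < m"
    by (rule order_tendstoD) (use \<open>0 < m\<close> in simp)
  then obtain n where n: "(LINT z|lebesgue. w z * indicator (S n) z) < m"
    by (auto simp: eventually_sequentially)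
  show ?thesis
  proof
    \<comment> \<open>The support of \<open>\<psi> \<rho>\<close> reaches up to radius \<open>2 \<rho>\<close>, hence the factor \<open>1 / 2\<close>.\<close>
    show "0 < h n / 2" "h n / 2 \<le> R" using h[of n] by auto
    fix \<rho> assume \<rho>: "0 < \<rho>" "\<rho> \<le> h n / 2"
    then have "\<rho> \<le> R" using h[of n] by simp
    obtain K' where K': "K' \<subseteq> ball 0 (2 * \<rho>)" "\<And>x. x \<notin> K' \<Longrightarrow> \<psi> \<rho> x = 0"
      by (rule test_function_support[of "ball 0 (2 * \<rho>)" "\<psi> \<rho>"])
         (use \<psi>[OF \<rho>(1) \<open>\<rho> \<le> R\<close>] in \<open>auto simp: space_cutoff_def\<close>)
    have "indicator (cylinder R T) z *\<^sub>R (1/2 * (norm (u z))\<^sup>2 * (cutoff \<eta> \<psi> \<rho> z powr \<delta>))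
        \<le> w z * indicator (S n) z" for z
    proof (cases "cutoff \<eta> \<psi> \<rho> z = 0")
      case True
      then show ?thesis by (simp add: w_def)
    next
      case False
      obtain x t where z: "z = (x, t)" by force
      have "x \<in> K'" "t \<in> L"
        using False K'(2)[of x] L(3)[of t] by (auto simp: cutoff_def z)
      then have "x \<in> ball 0 (2 * \<rho>)" using K'(1) by blast
      then have "norm x < h n" "norm x \<le> R" using \<rho>(2) h[of n] by auto
      then have "z \<in> S n" "z \<in> K"
        using \<open>t \<in> L\<close> by (auto simp: z S_def K_def)
      moreover have "0 \<le> cutoff \<eta> \<psi> \<rho> z" "cutoff \<eta> \<psi> \<rho> z \<le> 1"
        using \<eta> \<psi>[OF \<rho>(1) \<open>\<rho> \<le> R\<close>]
        by (auto simp: z cutoff_def time_cutoff_def space_cutoff_def intro: mult_le_one)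
      then have "cutoff \<eta> \<psi> \<rho> z powr \<delta> \<le> 1"
        using \<open>0 < \<delta>\<close> by (intro powr_le1) auto
      then have "1/2 * (norm (u z))\<^sup>2 * (cutoff \<eta> \<psi> \<rho> z powr \<delta>) \<le> 1/2 * (norm (u z))\<^sup>2"
        by (intro mult_left_le) auto
      ultimately show ?thesis
        by (simp add: w_def indicator_def)
    qed
    then have "(LINT z:cylinder R T|lebesgue. 1/2 * (norm (u z))\<^sup>2 * (cutoff \<eta> \<psi> \<rho> z powr \<delta>))
        \<le> (LINT z|lebesgue. w z * indicator (S n) z)"
      unfolding set_lebesgue_integral_def
      by (intro integral_mono'[OF wS]) (auto simp: w_def)
    with n show "(LINT z:cylinder R T|lebesgue. 1/2 * (norm (u z))\<^sup>2 * (cutoff \<eta> \<psi> \<rho> z powr \<delta>)) < m"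
      by simp
  qed
qed

section \<open>The cascade condition\<close>

theorem theorem4p1:
  fixes K1 K2 :: nat and \<gamma> c C0 \<delta> R T Rstar :: real
    and \<eta> :: "real \<Rightarrow> real" and \<psi> :: "real \<Rightarrow> real^3 \<Rightarrow> real"
    and u :: "(real^3) \<times> real \<Rightarrow> real^3" and p :: "(real^3) \<times> real \<Rightarrow> real"
  assumes "0 < K1" and "0 < K2"
    and "0 < \<gamma>" and "\<gamma> < 1"
    and "0 < C0"
    and "c = sqrt (real K1 / (C0 * real K2))"
    and "0 < R" and "0 < T"
    and "0 < \<delta>" and "\<delta> \<le> 1"
    and "time_cutoff T \<delta> C0 \<eta>"
    and "\<And>\<rho>. 0 < \<rho> \<Longrightarrow> \<rho> \<le> R \<Longrightarrow> space_cutoff \<rho> (\<psi> \<rho>)"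
    and "euler_weak_solution (cylinder R T) u p"
    and "local_energy_inequality (cylinder R T) u p"
    and "smooth_on ((ball 0 (2 * R) - {0}) \<times> {0<..<2 * T}) u"
    and "0 < Rstar" and "Rstar \<le> R"
    and "0 < anomalous_dissipation R T u p \<eta> \<psi> Rstar"
  shows "\<exists>R0star. 0 < R0star \<and> R0star \<le> R \<and>
           (\<forall>R0. 0 < R0 \<and> R0 \<le> R0star \<longrightarrow>
              0 < mean_dissipation R T u p \<eta> \<psi> R0 \<and>
              taylor_scale R T \<delta> u p \<eta> \<psi> R0 < \<gamma> * c * R0)"
proof -
  define E where "E = anomalous_dissipation R T u p \<eta> \<psi> Rstar"
  have E: "0 < E" using assms by (simp add: E_def)
  have c: "0 < c" using assms by simp
  \<comment> \<open>The energy threshold that is equivalent to \<open>\<tau>\<^sub>0 < \<gamma> c R0\<close> once the dissipation equals \<open>E\<close>.\<close>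
  define m where "m = (\<gamma> * c)\<^sup>2 * T * E"
  have m: "0 < m" using E c assms by (simp add: m_def)
  obtain r where r: "0 < r" "r \<le> R" and
    small: "\<And>\<rho>. 0 < \<rho> \<Longrightarrow> \<rho> \<le> r \<Longrightarrow>
      (LINT z:cylinder R T|lebesgue. 1/2 * (norm (u z))\<^sup>2 * (cutoff \<eta> \<psi> \<rho> z powr \<delta>)) < m"
    by (rule weighted_energy_small[OF assms(13,11,12,7,9) m]) blast+
  show ?thesis
  proof (intro exI[of _ r] conjI allI impI r; elim conjE)
    fix \<rho> assume \<rho>: "0 < \<rho>" "\<rho> \<le> r"
    define G where "G = (LINT z:cylinder R T|lebesgue. 1/2 * (norm (u z))\<^sup>2 * (cutoff \<eta> \<psi> \<rho> z powr \<delta>))"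
    have "\<rho> \<le> R" using \<rho> r by simp
    have "anomalous_dissipation R T u p \<eta> \<psi> \<rho> = E"
      unfolding E_def
      by (rule anomalous_dissipation_scale_invariant[OF assms(13,15,11,12) \<rho>(1) \<open>\<rho> \<le> R\<close> assms(16,17)])
    then have md: "mean_dissipation R T u p \<eta> \<psi> \<rho> = 1 / T * (1 / \<rho> ^ 3) * E"
      by (simp add: mean_dissipation_def)
    show "0 < mean_dissipation R T u p \<eta> \<psi> \<rho>"
      using md E \<rho> assms(8) by simp
    have "mean_energy R T \<delta> u \<eta> \<psi> \<rho> / mean_dissipation R T u p \<eta> \<psi> \<rho> = G / E"
      unfolding md mean_energy_def G_def[symmetric] using \<rho> assms(8) by (simp add: field_simps)
    then have "taylor_scale R T \<delta> u p \<eta> \<psi> \<rho> = sqrt (\<rho>\<^sup>2 / T * (G / E))"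
      by (simp add: taylor_scale_def)
    also have "\<dots> < sqrt ((\<gamma> * c * \<rho>)\<^sup>2)"
    proof (rule real_sqrt_less_mono)
      have "G / (T * E) < (\<gamma> * c)\<^sup>2"
        using small[OF \<rho>] E assms(8) by (simp add: G_def m_def pos_divide_less_eq mult.assoc)
      from mult_strict_left_mono[OF this, of "\<rho>\<^sup>2"]
      show "\<rho>\<^sup>2 / T * (G / E) < (\<gamma> * c * \<rho>)\<^sup>2"
        using \<rho>(1) by (simp add: power_mult_distrib mult_ac)
    qed
    also have "\<dots> = \<gamma> * c * \<rho>"
      using c \<rho> assms(3) by simp
    finally show "taylor_scale R T \<delta> u p \<eta> \<psi> \<rho> < \<gamma> * c * \<rho>" .
  qed
qed

end
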